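(* Let $n\ge1$. A function $f:\mathbb{T}^n\to\mathbb{C}$ is holomorphically extendable at a point of $\mathbb{T}^n$ if and only if it is real analytic at that point.
   Context: $\mathbb{T}$ is the unit circle in $\mathbb{C}$. A function $f:\mathbb{T}^n\to\mathbb{C}$ is real analytic at $(e^{i\theta_1},\dots,e^{i\theta_n})$, $\theta_i\in\mathbb{R}$, if there are $\delta>0$ and a power series $I(t_1,\dots,t_n)=\sum_{k_1,\dots,k_n\ge0}a_{k_1,\dots,k_n}(t_1-\theta_1)^{k_1}\cdots(t_n-\theta_n)^{k_n}$ (complex coefficients) converging absolutely and uniformly on $\prod_{i=1}^n[\theta_i-\delta,\theta_i+\delta]$ with $I(t_1,\dots,t_n)=f(e^{it_1},\dots,e^{it_n})$ there. A function $f:\mathbb{T}^n\to\mathbb{C}$ is holomorphically extendable at a point of $\mathbb{T}^n$ if there are an open neighborhood $U\subseteq\mathbb{C}^n$ of this point and a holomorphic function $F:U\to\mathbb{C}$ agreeing with $f$ on $U\cap\mathbb{T}^n$. *)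

theory Defs
  imports "HOL-Analysis.Analysis"
begin

definition torus :: "(complex ^ 'n) set" where
  "torus = {z. \<forall>i. norm (z $ i) = 1}"

definition torus_point :: "real ^ 'n \<Rightarrow> complex ^ 'n" where
  "torus_point \<theta> = (\<chi> i. cis (\<theta> $ i))"

(* Complex Frechet differentiability at each point of U (meant for open U): the derivative
   supplied by has_derivative is only real-linear, so C-linearity is demanded separately. *)
definition vec_holomorphic_on :: "(complex ^ 'n \<Rightarrow> complex) \<Rightarrow> (complex ^ 'n) set \<Rightarrow> bool" where
  "vec_holomorphic_on F U \<longleftrightarrow>
     (\<forall>z\<in>U. \<exists>D. (F has_derivative D) (at z) \<and> (\<forall>c v. D (c *s v) = c * D v))"

(* Functions on the torus are represented by functions on the whole space; both notions
   below depend only on the values on the torus. *)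
definition holomorphically_extendable_at :: "(complex ^ 'n \<Rightarrow> complex) \<Rightarrow> complex ^ 'n \<Rightarrow> bool" where
  "holomorphically_extendable_at f p \<longleftrightarrow>
     (\<exists>U F. open U \<and> p \<in> U \<and> vec_holomorphic_on F U \<and> (\<forall>z \<in> U \<inter> torus. F z = f z))"

definition box_around :: "real ^ 'n \<Rightarrow> real \<Rightarrow> (real ^ 'n) set" where
  "box_around \<theta> \<delta> = {t. \<forall>i. t $ i \<in> {\<theta> $ i - \<delta> .. \<theta> $ i + \<delta>}}"

definition series_term ::
  "(('n \<Rightarrow> nat) \<Rightarrow> complex) \<Rightarrow> real ^ 'n \<Rightarrow> ('n \<Rightarrow> nat) \<Rightarrow> real ^ 'n \<Rightarrow> complex" where
  "series_term a \<theta> k t = a k * (\<Prod>i\<in>UNIV. complex_of_real (t $ i - \<theta> $ i) ^ k i)"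

(* Uniform convergence is that of the net of sums over finite sets of multi-indices,
   so no enumeration of the multi-indices is chosen. *)
definition real_analytic_in_angles :: "(complex ^ 'n \<Rightarrow> complex) \<Rightarrow> real ^ 'n \<Rightarrow> bool" where
  "real_analytic_in_angles f \<theta> \<longleftrightarrow>
     (\<exists>\<delta>>0. \<exists>a.
        (\<forall>t \<in> box_around \<theta> \<delta>. (\<lambda>k. norm (series_term a \<theta> k t)) summable_on UNIV) \<and>
        uniform_limit (box_around \<theta> \<delta>)
          (\<lambda>K t. \<Sum>k\<in>K. series_term a \<theta> k t)
          (\<lambda>t. \<Sum>\<^sub>\<infinity>k. series_term a \<theta> k t)
          (finite_subsets_at_top UNIV) \<and>
        (\<forall>t \<in> box_around \<theta> \<delta>. (\<Sum>\<^sub>\<infinity>k. series_term a \<theta> k t) = f (torus_point t)))"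

definition real_analytic_at :: "(complex ^ 'n \<Rightarrow> complex) \<Rightarrow> complex ^ 'n \<Rightarrow> bool" where
  "real_analytic_at f p \<longleftrightarrow> (\<exists>\<theta>. p = torus_point \<theta> \<and> real_analytic_in_angles f \<theta>)"

(* The choice of the angles of p is immaterial. *)
lemma real_analytic_in_angles_shift:
  assumes eq: "torus_point \<theta> = torus_point \<theta>'" and an: "real_analytic_in_angles f \<theta>"
  shows "real_analytic_in_angles f \<theta>'"
proof -
  obtain \<delta> a where \<delta>: "\<delta> > 0"
    and abs: "\<And>t. t \<in> box_around \<theta> \<delta> \<Longrightarrow> (\<lambda>k. norm (series_term a \<theta> k t)) summable_on UNIV"
    and uni: "uniform_limit (box_around \<theta> \<delta>) (\<lambda>K t. \<Sum>k\<in>K. series_term a \<theta> k t)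
          (\<lambda>t. \<Sum>\<^sub>\<infinity>k. series_term a \<theta> k t) (finite_subsets_at_top UNIV)"
    and val: "\<And>t. t \<in> box_around \<theta> \<delta> \<Longrightarrow> (\<Sum>\<^sub>\<infinity>k. series_term a \<theta> k t) = f (torus_point t)"
    using an unfolding real_analytic_in_angles_def by blast
  define s where "s = (\<lambda>t. t + (\<theta> - \<theta>'))"
  have box: "s t \<in> box_around \<theta> \<delta>" if "t \<in> box_around \<theta>' \<delta>" for t
    using that by (auto simp: s_def box_around_def algebra_simps)
  have st: "series_term a \<theta> k (s t) = series_term a \<theta>' k t" for k t
    by (simp add: s_def series_term_def)
  have c: "cis (\<theta> $ i) = cis (\<theta>' $ i)" for i
    using eq by (simp add: torus_point_def vec_eq_iff)
  have tp: "torus_point (s t) = torus_point t" for t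
    by (simp add: s_def torus_point_def vec_eq_iff c flip: cis_mult cis_divide)
  have "uniform_limit (box_around \<theta>' \<delta>) (\<lambda>K t. \<Sum>k\<in>K. series_term a \<theta>' k t)
          (\<lambda>t. \<Sum>\<^sub>\<infinity>k. series_term a \<theta>' k t) (finite_subsets_at_top UNIV)"
    using uniform_limit_compose'[OF uni, of s "box_around \<theta>' \<delta>"] box by (simp add: st Pi_iff)
  then show ?thesis
    unfolding real_analytic_in_angles_def
    using \<delta> abs[OF box] val[OF box] by (auto simp: st tp intro!: exI[of _ \<delta>] exI[of _ a])
qed

lemma real_analytic_at_torus_point:
  "real_analytic_at f (torus_point \<theta>) \<longleftrightarrow> real_analytic_in_angles f \<theta>"
  unfolding real_analytic_at_def by (metis real_analytic_in_angles_shift)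

end

theory Submission
  imports Defs "HOL-Complex_Analysis.Cauchy_Integral_Formula"
    "HOL-Probability.Infinite_Product_Measure"
begin

text \<open>
  Passing to the angles turns both notions into statements about power series. In the coordinates
  \<open>w\<close> with \<open>z\<^sub>j = exp (\<i> (\<theta>\<^sub>j + w\<^sub>j))\<close>, the torus near \<open>torus_point \<theta>\<close> is the set of real
  \<open>w\<close>, and the change of coordinates is biholomorphic near \<open>w = 0\<close>, with inverse
  \<open>w\<^sub>j = - \<i> Ln (z\<^sub>j / exp (\<i> \<theta>\<^sub>j))\<close>.

  If \<open>f\<close> is real analytic in the angles, absolute convergence at the corner
  \<open>\<theta> + (\<delta>, \<dots>, \<delta>)\<close> of the box dominates the series on the whole complex polydisc of radius
  \<open>\<delta>\<close>. Its sum is holomorphic there (\<open>vec_holomorphic_on_power_series\<close>, by termwise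
  differentiation), and composing it with the logarithms gives the extension of \<open>f\<close>.

  If \<open>f\<close> has a holomorphic extension \<open>F\<close>, then \<open>G w = F (exp (\<i> (\<theta> + w)))\<close> is holomorphic near
  \<open>0\<close> and has to be expanded into a power series
  (\<open>separately_holomorphic_power_series\<close>). The one-variable Cauchy formula, applied in one
  coordinate after the other, writes \<open>G w\<close> as the mean over \<open>|\<zeta>\<^sub>j| = R\<close> of
  \<open>G \<zeta> (\<Prod>\<^sub>j \<zeta>\<^sub>j / (\<zeta>\<^sub>j - w\<^sub>j))\<close> (\<open>Cauchy_closed_polydisc\<close>). Each factor is a geometric series in
  \<open>w\<^sub>j / \<zeta>\<^sub>j\<close>, and integrating the product series term by term gives coefficients \<open>a\<^sub>k\<close> with
  \<open>|a\<^sub>k| R\<^bsup>|k|\<^esup>\<close> bounded. On the polydisc of radius \<open>R / 2\<close> the series is therefore dominated by a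
  multiple of \<open>\<Sum>\<^sub>k 2\<^bsup>-|k|\<^esup>\<close>, and the Weierstrass test yields the required uniform convergence.
\<close>

section \<open>Holomorphic functions of several variables\<close>

lemma has_derivative_vec_lambda:
  fixes f :: "'n::finite \<Rightarrow> 'a::real_normed_vector \<Rightarrow> 'b::euclidean_space"
  assumes "\<And>i. (f i has_derivative f' i) (at x within S)"
  shows "((\<lambda>x. \<chi> i. f i x) has_derivative (\<lambda>h. \<chi> i. f' i h)) (at x within S)"
proof (rule has_derivative_componentwise_within[THEN iffD2], rule ballI)
  fix b :: "'b ^ 'n" assume "b \<in> Basis"
  then obtain i c where b: "b = axis i c"
    unfolding Basis_vec_def by blast
  show "((\<lambda>x. (\<chi> i. f i x) \<bullet> b) has_derivative (\<lambda>h. (\<chi> i. f' i h) \<bullet> b)) (at x within S)"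
    unfolding b inner_axis vec_lambda_beta using assms[of i] by (rule has_derivative_inner_left)
qed

text \<open>Both the passage to the angles and its inverse act on each coordinate separately, so this
  special case of the chain rule serves both directions.\<close>

lemma vec_holomorphic_on_coordinatewise:
  fixes F :: "complex ^ 'n \<Rightarrow> complex" and h :: "'n \<Rightarrow> complex \<Rightarrow> complex"
  assumes F: "vec_holomorphic_on F V"
    and h: "\<And>z i. z \<in> U \<Longrightarrow> h i field_differentiable (at (z $ i))"
    and sub: "\<And>z. z \<in> U \<Longrightarrow> (\<chi> i. h i (z $ i)) \<in> V"
  shows "vec_holomorphic_on (\<lambda>z. F (\<chi> i. h i (z $ i))) U"
  unfolding vec_holomorphic_on_def
proof
  fix z assume z: "z \<in> U"
  obtain D where D: "(F has_derivative D) (at (\<chi> i. h i (z $ i)))"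
    and lin: "\<And>c v. D (c *s v) = c * D v"
    using bspec[OF F[unfolded vec_holomorphic_on_def] sub[OF z]] by auto
  obtain h' where h': "\<And>i. (h i has_field_derivative h' i) (at (z $ i))"
    using h[OF z] unfolding field_differentiable_def by metis
  have comp: "((\<lambda>z. h i (z $ i)) has_derivative (\<lambda>v. h' i * v $ i)) (at z)" for i
    using has_derivative_compose[OF bounded_linear_imp_has_derivative[OF bounded_linear_vec_nth, of i "at z"]
        h'[unfolded has_field_derivative_def]] by simp
  have "((\<lambda>z. \<chi> i. h i (z $ i)) has_derivative (\<lambda>v. \<chi> i. h' i * v $ i)) (at z)"
    by (rule has_derivative_vec_lambda) (rule comp)
  then have "((\<lambda>z. F (\<chi> i. h i (z $ i))) has_derivative (\<lambda>v. D (\<chi> i. h' i * v $ i))) (at z)"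
    using D by (rule has_derivative_compose)
  moreover have "D (\<chi> i. h' i * (c *s v) $ i) = c * D (\<chi> i. h' i * v $ i)" for c v
  proof -
    have "(\<chi> i. h' i * (c *s v) $ i) = c *s (\<chi> i. h' i * v $ i)"
      by (simp add: vec_eq_iff)
    then show ?thesis by (simp add: lin)
  qed
  ultimately show "\<exists>D. ((\<lambda>z. F (\<chi> i. h i (z $ i))) has_derivative D) (at z) \<and> (\<forall>c v. D (c *s v) = c * D v)"
    by (intro exI[of _ "\<lambda>v. D (\<chi> i. h' i * v $ i)"]) simp
qed

text \<open>The restriction to a line parallel to a coordinate axis is a function of one variable, to
  which the classical theory applies.\<close>

lemma vec_holomorphic_on_coordinate_line:
  fixes F :: "complex ^ 'n \<Rightarrow> complex"
  assumes F: "vec_holomorphic_on F V"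
    and sub: "\<And>u. u \<in> A \<Longrightarrow> (\<chi> i. if i = j then u else w $ i) \<in> V"
  shows "(\<lambda>u. F (\<chi> i. if i = j then u else w $ i)) holomorphic_on A"
  unfolding holomorphic_on_def
proof
  fix u assume u: "u \<in> A"
  obtain D where D: "(F has_derivative D) (at (\<chi> i. if i = j then u else w $ i))"
    and lin: "\<And>c v. D (c *s v) = c * D v"
    using bspec[OF F[unfolded vec_holomorphic_on_def] sub[OF u]] by auto
  have "((\<lambda>u. \<chi> i. if i = j then u else w $ i) has_derivative (\<lambda>h. \<chi> i. if i = j then h else 0)) (at u)"
  proof (rule has_derivative_vec_lambda)
    show "((\<lambda>u. if i = j then u else w $ i) has_derivative (\<lambda>h. if i = j then h else 0)) (at u)" for i
      by (cases "i = j") simp_all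
  qed
  then have "((\<lambda>u. F (\<chi> i. if i = j then u else w $ i)) has_derivative
      (\<lambda>h. D (\<chi> i. if i = j then h else 0))) (at u)"
    using D by (rule has_derivative_compose)
  moreover have "(\<chi> i. if i = j then h else 0) = h *s axis j 1" for h :: complex
    by (simp add: vec_eq_iff axis_def)
  ultimately have "((\<lambda>u. F (\<chi> i. if i = j then u else w $ i)) has_derivative
      (\<lambda>h. D (axis j 1) * h)) (at u)"
    by (simp add: lin mult.commute)
  then show "(\<lambda>u. F (\<chi> i. if i = j then u else w $ i)) field_differentiable (at u within A)"
    unfolding field_differentiable_def has_field_derivative_def
    by (intro exI[of _ "D (axis j 1)"]) (rule has_derivative_at_withinI)
qed

section \<open>Holomorphy of sums of power series\<close>

text \<open>A Cauchy estimate for monomials: shrinking the radius from \<open>d\<close> to \<open>r\<close> pays for the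
  factor \<open>n\<close> that differentiation produces.\<close>

lemma power_deriv_le:
  fixes r d :: real
  assumes "0 \<le> r" "r < d"
  shows "real n * r ^ (n - 1) \<le> d ^ n / (d - r)"
proof -
  have "real n * r ^ (n - 1) * (d - r) \<le> d ^ n"
  proof (induction n)
    case (Suc n)
    have "real (Suc n) * r ^ n * (d - r) = r * (real n * r ^ (n - 1) * (d - r)) + r ^ n * (d - r)"
      by (cases n) (simp_all add: algebra_simps)
    also have "\<dots> \<le> r * d ^ n + d ^ n * (d - r)"
      using Suc assms by (intro add_mono mult_left_mono mult_right_mono power_mono) auto
    finally show ?case by (simp add: algebra_simps)
  qed simp
  then show ?thesis using assms by (simp add: field_simps)
qed

text \<open>Termwise differentiation. Near a point the coordinates stay below some \<open>r < d\<close>, and there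
  the derivative of the \<open>k\<close>-th term is bounded, uniformly in the point, by a constant times
  \<open>|a\<^sub>k| d\<^bsup>|k|\<^esup>\<close>, the term of a convergent series. The multi-indices are enumerated by the natural
  numbers so that the theorem on differentiating sequences of functions applies; its limit
  derivative inherits complex linearity from the terms.\<close>

lemma vec_holomorphic_on_power_series:
  fixes a :: "('n::finite \<Rightarrow> nat) \<Rightarrow> complex"
  assumes d: "(\<lambda>k. norm (a k) * (\<Prod>i\<in>UNIV. d ^ k i)) summable_on UNIV"
  shows "vec_holomorphic_on (\<lambda>w. \<Sum>\<^sub>\<infinity>k. a k * (\<Prod>i\<in>UNIV. (w $ i) ^ k i)) {w. \<forall>i. norm (w $ i) < d}"
  unfolding vec_holomorphic_on_def
proof
  fix w :: "complex ^ 'n" assume w: "w \<in> {w. \<forall>i. norm (w $ i) < d}"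
  define m where "m = Max (range (\<lambda>i. norm (w $ i)))"
  define r where "r = (m + d) / 2"
  have "m < d"
    using w unfolding m_def by (subst Max_less_iff) auto
  have le_m: "norm (w $ i) \<le> m" for i
    unfolding m_def by (rule Max_ge) auto
  have wr: "norm (w $ i) < r" for i
    using le_m[of i] \<open>m < d\<close> by (simp add: r_def)
  have r: "0 \<le> r" "r < d"
    using order_trans[OF norm_ge_zero wr[of undefined, THEN less_imp_le]] \<open>m < d\<close> by (simp_all add: r_def)
  have "open {x :: complex ^ 'n. \<forall>i. x $ i \<in> ball 0 r}"
    by (rule open_vector_box) auto
  moreover have "w \<in> {x. \<forall>i. x $ i \<in> ball 0 r}"
    using wr by auto
  ultimately obtain \<rho> where \<rho>: "\<rho> > 0" "ball w \<rho> \<subseteq> {x. \<forall>i. x $ i \<in> ball 0 r}"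
    by (meson open_contains_ball)
  have xr: "norm (x $ i) \<le> r" if "x \<in> ball w \<rho>" for x i
  proof -
    have "x \<in> {x. \<forall>i. x $ i \<in> ball 0 r}"
      using that \<rho>(2) by (rule rev_subsetD)
    then show ?thesis by (auto simp: less_imp_le)
  qed
  have "infinite (UNIV :: ('n \<Rightarrow> nat) set)"
    using finite_fun_UNIVD2 infinite_UNIV_nat by blast
  then obtain e :: "nat \<Rightarrow> 'n \<Rightarrow> nat" where e: "bij_betw e UNIV UNIV"
    using bij_betw_from_nat_into[of "UNIV :: ('n \<Rightarrow> nat) set"] by auto
  define P where "P = (\<lambda>x :: complex ^ 'n. \<Sum>\<^sub>\<infinity>k. a k * (\<Prod>i\<in>UNIV. (x $ i) ^ k i))"
  define f where "f = (\<lambda>n (x :: complex ^ 'n). a (e n) * (\<Prod>i\<in>UNIV. (x $ i) ^ e n i))"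
  define f' where "f' = (\<lambda>n (x :: complex ^ 'n) (h :: complex ^ 'n). a (e n) *
    (\<Sum>i\<in>UNIV. (of_nat (e n i) * h $ i * (x $ i) ^ (e n i - 1)) * (\<Prod>j\<in>UNIV - {i}. (x $ j) ^ e n j)))"
  define g' where "g' = (\<lambda>x h. \<Sum>n. f' n x h)"
  define b where "b = (\<lambda>n. norm (a (e n)) * (\<Prod>i\<in>UNIV. d ^ e n i))"
  define C where "C = real CARD('n) / (d - r)"
  have C: "C > 0" using r by (simp add: C_def)
  have b: "summable b"
    using d summable_on_reindex_bij_betw[OF e, of "\<lambda>k. norm (a k) * (\<Prod>i\<in>UNIV. d ^ k i)"]
    unfolding b_def by (intro summable_on_imp_summable) simp
  have bound: "norm (f' n x h) \<le> C * b n * norm h" if x: "x \<in> ball w \<rho>" for n x h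
  proof -
    have "norm (\<Sum>i\<in>UNIV. (of_nat (e n i) * h $ i * (x $ i) ^ (e n i - 1)) * (\<Prod>j\<in>UNIV - {i}. (x $ j) ^ e n j))
        \<le> (\<Sum>i\<in>(UNIV :: 'n set). norm h / (d - r) * (\<Prod>j\<in>UNIV. d ^ e n j))"
    proof (rule sum_norm_le)
      fix i :: 'n
      have "real (e n i) * norm (x $ i) ^ (e n i - 1) \<le> real (e n i) * r ^ (e n i - 1)"
        by (intro mult_left_mono power_mono xr x) auto
      also have "\<dots> \<le> d ^ e n i / (d - r)"
        by (rule power_deriv_le) (use r in auto)
      finally have 1: "real (e n i) * norm (x $ i) ^ (e n i - 1) \<le> d ^ e n i / (d - r)" .
      have 2: "(\<Prod>j\<in>UNIV - {i}. norm (x $ j) ^ e n j) \<le> (\<Prod>j\<in>UNIV - {i}. d ^ e n j)"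
        using xr[OF x] r by (intro prod_mono conjI power_mono) (auto intro: order_trans less_imp_le)
      have "norm ((of_nat (e n i) * h $ i * (x $ i) ^ (e n i - 1)) * (\<Prod>j\<in>UNIV - {i}. (x $ j) ^ e n j))
        = norm (h $ i) * (real (e n i) * norm (x $ i) ^ (e n i - 1)) * (\<Prod>j\<in>UNIV - {i}. norm (x $ j) ^ e n j)"
        by (simp add: norm_mult norm_power prod_norm[symmetric])
      also have "\<dots> \<le> norm h * (d ^ e n i / (d - r)) * (\<Prod>j\<in>UNIV - {i}. d ^ e n j)"
        using r by (intro mult_mono 1 2 Finite_Cartesian_Product.norm_nth_le mult_nonneg_nonneg prod_nonneg) auto
      also have "\<dots> = norm h / (d - r) * (\<Prod>j\<in>UNIV. d ^ e n j)"
        by (subst prod.remove[of UNIV i]) auto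
      finally show "norm ((of_nat (e n i) * h $ i * (x $ i) ^ (e n i - 1)) * (\<Prod>j\<in>UNIV - {i}. (x $ j) ^ e n j))
        \<le> norm h / (d - r) * (\<Prod>j\<in>UNIV. d ^ e n j)" .
    qed
    then have "norm (f' n x h) \<le> norm (a (e n)) * (\<Sum>i\<in>(UNIV :: 'n set). norm h / (d - r) * (\<Prod>j\<in>UNIV. d ^ e n j))"
      unfolding f'_def norm_mult by (rule mult_left_mono) simp
    also have "\<dots> = C * b n * norm h"
      by (simp add: C_def b_def)
    finally show ?thesis .
  qed
  have summ': "summable (\<lambda>n. norm (f' n x h))" if "x \<in> ball w \<rho>" for x h
    by (rule summable_comparison_test'[of "\<lambda>n. C * b n * norm h" 0])
       (use bound[OF that] b in \<open>auto intro!: summable_mult summable_mult2\<close>)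
  have deriv: "(f n has_derivative f' n x) (at x within ball w \<rho>)" for n x
    unfolding f_def f'_def
    by (rule has_derivative_mult_right has_derivative_prod)+
       (auto intro!: derivative_eq_intros bounded_linear_imp_has_derivative bounded_linear_vec_nth)
  have unif: "\<forall>\<^sub>F n in sequentially. \<forall>x\<in>ball w \<rho>. \<forall>h. norm (sum (\<lambda>i. f' i x h) {..<n} - g' x h) \<le> \<epsilon> * norm h"
    if "\<epsilon> > 0" for \<epsilon>
  proof -
    have "(\<lambda>n. C * (suminf b - (\<Sum>i<n. b i))) \<longlonglongrightarrow> C * (suminf b - suminf b)"
      by (intro tendsto_intros summable_LIMSEQ b)
    then have "\<forall>\<^sub>F n in sequentially. C * (suminf b - (\<Sum>i<n. b i)) < \<epsilon>"
      using that by (intro order_tendstoD) auto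
    then show ?thesis
    proof eventually_elim
      case (elim n)
      show ?case
      proof (intro ballI allI)
        fix x h assume x: "x \<in> ball w \<rho>"
        have s: "summable (\<lambda>i. norm (f' (i + n) x h))"
          using summ'[OF x] by (rule summable_ignore_initial_segment)
        have sb: "summable (\<lambda>i. C * b (i + n) * norm h)"
          by (intro summable_mult summable_mult2 summable_ignore_initial_segment b)
        have "norm (sum (\<lambda>i. f' i x h) {..<n} - g' x h) = norm (\<Sum>i. f' (i + n) x h)"
          unfolding g'_def
          by (subst suminf_minus_initial_segment) (auto simp: norm_minus_commute intro: summable_norm_cancel summ' x)
        also have "\<dots> \<le> (\<Sum>i. norm (f' (i + n) x h))"
          using s by (rule summable_norm)
        also have "\<dots> \<le> (\<Sum>i. C * b (i + n) * norm h)"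
          using bound[OF x] s sb by (rule suminf_le)
        also have "\<dots> = C * (\<Sum>i. b (i + n)) * norm h"
          using b by (simp add: suminf_mult suminf_mult2[symmetric] summable_ignore_initial_segment summable_mult)
        also have "\<dots> = C * (suminf b - (\<Sum>i<n. b i)) * norm h"
          using b by (subst suminf_minus_initial_segment) auto
        also have "\<dots> \<le> \<epsilon> * norm h"
          using elim by (intro mult_right_mono) auto
        finally show "norm (sum (\<lambda>i. f' i x h) {..<n} - g' x h) \<le> \<epsilon> * norm h" .
      qed
    qed
  qed
  have sums: "(\<lambda>n. f n x) sums P x" if x: "x \<in> ball w \<rho>" for x
  proof -
    have "(\<lambda>k. norm (a k * (\<Prod>i\<in>UNIV. (x $ i) ^ k i))) summable_on UNIV"
    proof (rule summable_on_comparison_test[OF d])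
      fix k :: "'n \<Rightarrow> nat"
      have "(\<Prod>i\<in>UNIV. norm (x $ i) ^ k i) \<le> (\<Prod>i\<in>UNIV. d ^ k i)"
        using xr[OF x] r by (intro prod_mono conjI power_mono) (auto intro: order_trans less_imp_le)
      then show "norm (a k * (\<Prod>i\<in>UNIV. (x $ i) ^ k i)) \<le> norm (a k) * (\<Prod>i\<in>UNIV. d ^ k i)"
        by (simp add: norm_mult norm_power prod_norm[symmetric] mult_left_mono)
    qed auto
    then have "((\<lambda>k. a k * (\<Prod>i\<in>UNIV. (x $ i) ^ k i)) has_sum P x) UNIV"
      unfolding P_def by (rule has_sum_infsum[OF abs_summable_summable])
    then have "((\<lambda>n. f n x) has_sum P x) UNIV"
      using has_sum_reindex_bij_betw[OF e, of "\<lambda>k. a k * (\<Prod>i\<in>UNIV. (x $ i) ^ k i)"] by (simp add: f_def)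
    then show ?thesis by (rule has_sum_imp_sums)
  qed
  have wb: "w \<in> ball w \<rho>" using \<rho> by simp
  obtain g where g: "\<And>x. x \<in> ball w \<rho> \<Longrightarrow> (\<lambda>n. f n x) sums g x"
    "\<And>x. x \<in> ball w \<rho> \<Longrightarrow> (g has_derivative g' x) (at x within ball w \<rho>)"
    using has_derivative_series[OF convex_ball deriv unif wb sums[OF wb]] by blast
  have "g x = P x" if "x \<in> ball w \<rho>" for x
    using g(1)[OF that] sums[OF that] by (rule sums_unique2)
  moreover have "(g has_derivative g' w) (at w)"
    using g(2)[OF wb] at_within_open[OF wb open_ball] by simp
  ultimately have "(P has_derivative g' w) (at w)"
    using wb by (intro has_derivative_transform_within_open[of g "g' w" w UNIV "ball w \<rho>" P]) auto
  moreover have "g' w (c *s v) = c * g' w v" for c v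
  proof -
    have "f' n w (c *s v) = c * f' n w v" for n
      by (simp add: f'_def sum_distrib_left algebra_simps)
    then show ?thesis
      using summable_norm_cancel[OF summ'[OF wb]] by (simp add: g'_def suminf_mult)
  qed
  ultimately show "\<exists>D. ((\<lambda>w. \<Sum>\<^sub>\<infinity>k. a k * (\<Prod>i\<in>UNIV. (w $ i) ^ k i)) has_derivative D) (at w) \<and>
      (\<forall>c v. D (c *s v) = c * D v)"
    unfolding P_def by (intro exI[of _ "g' w"]) simp
qed

section \<open>Geometric series and termwise integration\<close>

text \<open>The product of the one-variable geometric series, multiplied out.\<close>

lemma has_sum_prod_geometric:
  fixes x :: "'n::finite \<Rightarrow> 'a::{real_normed_field, banach}"
  assumes x: "\<And>i. norm (x i) < 1"
  shows "((\<lambda>k. \<Prod>i\<in>UNIV. x i ^ k i) has_sum (\<Prod>i\<in>UNIV. 1 / (1 - x i))) UNIV"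
proof -
  have geo: "(\<lambda>m. norm (c ^ m)) summable_on UNIV" "(\<Sum>\<^sub>\<infinity>m. c ^ m) = 1 / (1 - c)"
    if "norm c < 1" for c :: "'b::{real_normed_field, banach}"
  proof -
    have sum: "summable (\<lambda>m. norm c ^ m)"
      using that by (intro summable_geometric) simp
    show "(\<lambda>m. norm (c ^ m)) summable_on UNIV"
      using sum by (intro norm_summable_imp_summable_on) (simp add: norm_power)
    have "((\<lambda>m. c ^ m) has_sum 1 / (1 - c)) UNIV"
      using sum by (intro norm_summable_imp_has_sum geometric_sums that) (simp add: norm_power)
    then show "(\<Sum>\<^sub>\<infinity>m. c ^ m) = 1 / (1 - c)"
      by (rule infsumI)
  qed
  have prod: "(\<Sum>\<^sub>\<infinity>k. \<Prod>i\<in>UNIV. y i ^ k i) = (\<Prod>i\<in>UNIV. 1 / (1 - y i))"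
    if y: "\<And>i. norm (y i) < 1" for y :: "'n \<Rightarrow> 'b::{real_normed_field, banach}"
  proof -
    have "(\<Sum>\<^sub>\<infinity>k\<in>PiE UNIV (\<lambda>_. UNIV). \<Prod>i\<in>UNIV. y i ^ k i) = (\<Prod>i\<in>UNIV. \<Sum>\<^sub>\<infinity>m. y i ^ m)"
      by (rule infsum_prod_PiE_abs) (auto intro: geo y)
    then show ?thesis by (simp add: geo y)
  qed
  \<comment> \<open>The product formula gives the value of the sum without its convergence. A sum that does not
      converge is 0 by default, so a nonzero value shows that it converges.\<close>
  have "(\<Sum>\<^sub>\<infinity>k. \<Prod>i\<in>UNIV. norm (x i) ^ k i) \<noteq> 0"
    using x by (subst prod) (simp_all add: less_imp_neq)
  then have "(\<lambda>k. \<Prod>i\<in>UNIV. norm (x i) ^ k i) summable_on UNIV"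
    using infsum_not_exists by blast
  then have "(\<lambda>k. norm (\<Prod>i\<in>UNIV. x i ^ k i)) summable_on UNIV"
    by (simp only: norm_power prod_norm[symmetric])
  then have "(\<lambda>k. \<Prod>i\<in>UNIV. x i ^ k i) summable_on UNIV"
    by (rule abs_summable_summable)
  then show ?thesis
    unfolding prod[OF x, symmetric] by (rule has_sum_infsum)
qed

text \<open>A dominated series converges uniformly by the Weierstrass test, and on a probability space
  the integral is continuous under uniform limits.\<close>

lemma has_sum_integral:
  fixes f :: "'k \<Rightarrow> 'a \<Rightarrow> 'b::{banach, second_countable_topology}"
  assumes M: "prob_space M"
    and bound: "\<And>k x. x \<in> space M \<Longrightarrow> norm (f k x) \<le> B k"
    and summable: "B summable_on UNIV"
    and int: "\<And>k. integrable M (f k)"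
    and F: "\<And>x. x \<in> space M \<Longrightarrow> ((\<lambda>k. f k x) has_sum F x) UNIV"
    and intF: "integrable M F"
  shows "((\<lambda>k. integral\<^sup>L M (f k)) has_sum integral\<^sup>L M F) UNIV"
proof -
  interpret prob_space M by (rule M)
  have unif: "uniform_limit (space M) (\<lambda>K x. \<Sum>k\<in>K. f k x) F (finite_subsets_at_top UNIV)"
    using bound F summable by (rule Weierstrass_m_test_general')
  show ?thesis
    unfolding has_sum_def
  proof (rule tendstoI)
    fix e :: real assume "e > 0"
    then have "\<forall>\<^sub>F K in finite_subsets_at_top UNIV. \<forall>x\<in>space M. dist (\<Sum>k\<in>K. f k x) (F x) < e / 2"
      using unif half_gt_zero unfolding uniform_limit_iff by blast
    then show "\<forall>\<^sub>F K in finite_subsets_at_top UNIV. dist (\<Sum>k\<in>K. integral\<^sup>L M (f k)) (integral\<^sup>L M F) < e"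
    proof eventually_elim
      case (elim K)
      have "dist (\<Sum>k\<in>K. integral\<^sup>L M (f k)) (integral\<^sup>L M F) = norm (\<integral>x. (\<Sum>k\<in>K. f k x) - F x \<partial>M)"
        using int intF by (simp add: dist_norm)
      also have "\<dots> \<le> (\<integral>x. norm ((\<Sum>k\<in>K. f k x) - F x) \<partial>M)"
        by (rule integral_norm_bound)
      also have "\<dots> \<le> (\<integral>x. e / 2 \<partial>M)"
        using int intF elim by (intro integral_mono) (auto simp: dist_norm less_imp_le)
      also have "\<dots> < e"
        using \<open>e > 0\<close> by (simp add: prob_space)
      finally show ?case .
    qed
  qed
qed

section \<open>Polydiscs\<close>

definition closed_polydisc :: "real \<Rightarrow> (complex ^ 'n) set" where
  "closed_polydisc R = {z. \<forall>i. norm (z $ i) \<le> R}"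

lemma norm_le_closed_polydisc:
  assumes "z \<in> closed_polydisc R"
  shows "norm (z :: complex ^ 'n) \<le> real CARD('n) * R"
proof -
  have "norm z \<le> (\<Sum>i\<in>UNIV. norm (z $ i))"
    unfolding norm_vec_def by (rule L2_set_le_sum) simp
  also have "\<dots> \<le> (\<Sum>i\<in>(UNIV :: 'n set). R)"
    using assms by (intro sum_mono) (simp add: closed_polydisc_def)
  finally show ?thesis by simp
qed

lemma compact_closed_polydisc: "compact (closed_polydisc R :: (complex ^ 'n) set)"
  unfolding compact_eq_bounded_closed
proof
  have "closed {z :: complex ^ 'n. \<forall>i. z $ i \<in> cball 0 R}"
    by (rule closed_vector_box) simp
  then show "closed (closed_polydisc R :: (complex ^ 'n) set)"
    by (simp add: closed_polydisc_def)
  show "bounded (closed_polydisc R :: (complex ^ 'n) set)"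
    by (rule boundedI) (rule norm_le_closed_polydisc)
qed

lemma closed_polydisc_subset_open:
  assumes "open V" "(0 :: complex ^ 'n) \<in> V"
  obtains R where "R > 0" "closed_polydisc R \<subseteq> V"
proof -
  obtain \<rho> where \<rho>: "\<rho> > 0" "ball 0 \<rho> \<subseteq> V"
    using assms by (meson open_contains_ball)
  define R where "R = \<rho> / (2 * real CARD('n))"
  have "closed_polydisc R \<subseteq> ball (0 :: complex ^ 'n) \<rho>"
  proof
    fix z :: "complex ^ 'n" assume "z \<in> closed_polydisc R"
    then have "norm z \<le> real CARD('n) * R" by (rule norm_le_closed_polydisc)
    also have "\<dots> < \<rho>" using \<rho>(1) by (simp add: R_def field_simps)
    finally show "z \<in> ball 0 \<rho>" by simp
  qed
  then show thesis using that[of R] \<rho> by (auto simp: R_def)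
qed

section \<open>The Cauchy integral formula on a polydisc\<close>

definition unit_interval_measure :: "real measure" where
  "unit_interval_measure = restrict_space lborel {0..1}"

lemma prob_space_unit_interval_measure: "prob_space unit_interval_measure"
  by (rule prob_spaceI) (simp add: unit_interval_measure_def emeasure_restrict_space space_restrict_space)

lemma circlepath_measurable [measurable]:
  "circlepath z R \<in> borel_measurable unit_interval_measure"
proof -
  have "circlepath z R \<in> borel_measurable borel"
    unfolding circlepath by (intro borel_measurable_continuous_onI continuous_intros)
  then show ?thesis
    unfolding unit_interval_measure_def by (intro measurable_restrict_space1) simp
qed

lemma norm_circlepath_0 [simp]: "R \<ge> 0 \<Longrightarrow> norm (circlepath 0 R x) = R"
  by (simp add: circlepath norm_mult mult.commute[of _ \<i>] flip: cis_conv_exp)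

text \<open>The Cauchy formula as a mean value: for the parametrization \<open>\<zeta> = R exp (2 \<pi> \<i> x)\<close> one has
  \<open>d\<zeta> = 2 \<pi> \<i> \<zeta> dx\<close>, which cancels the factor \<open>2 \<pi> \<i>\<close> and leaves \<open>\<zeta>\<close> in the numerator. In this
  form the formula can be iterated with product measures.\<close>

lemma circle_mean_Cauchy:
  assumes R: "R > 0" and g: "g holomorphic_on cball 0 R" and w: "norm w < R"
  shows "(\<integral>x. g (circlepath 0 R x) * (circlepath 0 R x / (circlepath 0 R x - w)) \<partial>unit_interval_measure) = g w"
proof -
  define k where "k = (\<lambda>x. g (circlepath 0 R x) * (circlepath 0 R x / (circlepath 0 R x - w)))"
  have "((\<lambda>u. g u / (u - w)) has_contour_integral (2 * of_real pi * \<i> * g w)) (circlepath 0 R)"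
    using g w by (intro Cauchy_integral_circlepath_simple) auto
  then have "((\<lambda>x. g (circlepath 0 R x) / (circlepath 0 R x - w) *
      vector_derivative (circlepath 0 R) (at x within {0..1})) has_integral (2 * of_real pi * \<i> * g w)) {0..1}"
    by (simp add: has_contour_integral_def)
  also have "?this \<longleftrightarrow> ((\<lambda>x. (2 * of_real pi * \<i>) * k x) has_integral (2 * of_real pi * \<i> * g w)) {0..1}"
    by (rule has_integral_cong) (simp add: vector_derivative_circlepath01 k_def, simp add: circlepath)
  finally have "((\<lambda>x. inverse (2 * of_real pi * \<i>) * ((2 * of_real pi * \<i>) * k x)) has_integral
      inverse (2 * of_real pi * \<i>) * (2 * of_real pi * \<i> * g w)) {0..1}"
    by (rule has_integral_mult_right)
  then have int: "integral {0..1} k = g w"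
    by (intro integral_unique) (simp add: field_simps)
  have "continuous_on {0..1} (circlepath 0 R)"
    unfolding circlepath by (intro continuous_intros)
  moreover have "circlepath 0 R x \<noteq> w" for x
    using norm_circlepath_0[of R x] R w by auto
  ultimately have "continuous_on {0..1} k"
    unfolding k_def using R
    by (intro continuous_intros continuous_on_compose2[OF holomorphic_on_imp_continuous_on[OF g]]) auto
  then have "set_integrable lborel {0..1} k"
    by (rule borel_integrable_atLeastAtMost')
  then have "(LINT x : {0..1} | lborel. k x) = g w"
    using set_borel_integral_eq_integral(2) int by metis
  then show ?thesis
    unfolding unit_interval_measure_def k_def[symmetric]
    by (simp add: integral_restrict_space set_lebesgue_integral_def)
qed

text \<open>The point with \<open>S\<close>-coordinates on the circle of radius \<open>R\<close>, at the angles \<open>2 \<pi> x\<^sub>i\<close>, and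
  with the other coordinates of \<open>w\<close>: an integrand of the Cauchy formula in which only the
  variables in \<open>S\<close> have been treated so far is evaluated at such points.\<close>

definition circle_coords :: "real \<Rightarrow> 'n set \<Rightarrow> complex ^ 'n \<Rightarrow> ('n \<Rightarrow> real) \<Rightarrow> complex ^ 'n" where
  "circle_coords R S w x = (\<chi> i. if i \<in> S then circlepath 0 R (x i) else w $ i)"

lemma circle_coords_in_closed_polydisc:
  "R \<ge> 0 \<Longrightarrow> w \<in> closed_polydisc R \<Longrightarrow> circle_coords R S w x \<in> closed_polydisc R"
  by (auto simp: circle_coords_def closed_polydisc_def)

lemma circle_coords_measurable:
  "circle_coords R S (w :: complex ^ 'n) \<in> borel_measurable (Pi\<^sub>M S (\<lambda>_. unit_interval_measure))"
proof (rule borel_measurable_euclidean_space[THEN iffD2], rule ballI)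
  fix b :: "complex ^ 'n" assume "b \<in> Basis"
  then obtain i c where b: "b = axis i c"
    unfolding Basis_vec_def by blast
  have "(\<lambda>x. circle_coords R S w x \<bullet> b) = (\<lambda>x. (if i \<in> S then circlepath 0 R (x i) else w $ i) \<bullet> c)"
    by (simp add: b inner_axis circle_coords_def fun_eq_iff)
  moreover have "(\<lambda>x. circlepath 0 R (x i)) \<in> borel_measurable (Pi\<^sub>M S (\<lambda>_. unit_interval_measure))" if "i \<in> S"
    using measurable_compose[OF measurable_component_singleton[OF that] circlepath_measurable] .
  ultimately show "(\<lambda>x. circle_coords R S w x \<bullet> b) \<in> borel_measurable (Pi\<^sub>M S (\<lambda>_. unit_interval_measure))"
    by (cases "i \<in> S") simp_all
qed

text \<open>The points in question run through a compact set, on which \<open>\<Phi>\<close> is bounded. Continuity is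
  asked for on this set only, because the kernels have poles inside the polydisc.\<close>

lemma integrable_circle_coords:
  fixes \<Phi> :: "complex ^ 'n \<Rightarrow> complex"
  assumes R: "R \<ge> 0" and w: "w \<in> closed_polydisc R"
    and cont: "continuous_on {z \<in> closed_polydisc R. \<forall>i\<in>S. norm (z $ i) = R} \<Phi>"
  shows "integrable (Pi\<^sub>M S (\<lambda>_. unit_interval_measure)) (\<lambda>x. \<Phi> (circle_coords R S w x))"
proof -
  interpret prob_space "Pi\<^sub>M S (\<lambda>_. unit_interval_measure)"
    by (intro prob_space_PiM prob_space_unit_interval_measure)
  let ?T = "{z \<in> closed_polydisc R. \<forall>i\<in>S. norm (z $ i) = R}"
  have mem: "circle_coords R S w x \<in> ?T" for x
    using circle_coords_in_closed_polydisc[OF R w] R by (simp add: circle_coords_def)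
  have "closed {z :: complex ^ 'n. \<forall>i. z $ i \<in> (if i \<in> S then sphere 0 R else UNIV)}"
    by (rule closed_vector_box) auto
  then have "compact (closed_polydisc R \<inter> {z :: complex ^ 'n. \<forall>i. z $ i \<in> (if i \<in> S then sphere 0 R else UNIV)})"
    by (rule compact_Int_closed[OF compact_closed_polydisc])
  also have "closed_polydisc R \<inter> {z. \<forall>i. z $ i \<in> (if i \<in> S then sphere 0 R else UNIV)} = ?T"
    by auto
  finally have compact: "compact ?T" .
  then have "compact (\<Phi> ` ?T)"
    using cont by (intro compact_continuous_image)
  then obtain B where B: "\<And>z. z \<in> ?T \<Longrightarrow> norm (\<Phi> z) \<le> B"
    by (meson bounded_iff compact_imp_bounded imageI)
  have "(\<lambda>z. indicator ?T z *\<^sub>R \<Phi> z) \<in> borel_measurable borel"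
    using compact cont by (intro borel_measurable_continuous_on_indicator borel_closed compact_imp_closed)
  \<comment> \<open>The indicator turns a function continuous on a closed set into a Borel function on the whole
      space; along the parametrization it is constantly 1.\<close>
  then have "(\<lambda>x. indicator ?T (circle_coords R S w x) *\<^sub>R \<Phi> (circle_coords R S w x))
      \<in> borel_measurable (Pi\<^sub>M S (\<lambda>_. unit_interval_measure))"
    using measurable_compose[OF circle_coords_measurable] by blast
  then have "(\<lambda>x. \<Phi> (circle_coords R S w x)) \<in> borel_measurable (Pi\<^sub>M S (\<lambda>_. unit_interval_measure))"
    using mem by (simp del: mem_Collect_eq)
  then show ?thesis
    using B[OF mem] by (intro integrable_const_bound[of _ B]) auto
qed

text \<open>Induction on the set \<open>S\<close> of coordinates that are integrated out. By Fubini, adding a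
  coordinate \<open>j\<close> inserts an inner integral, which the one-variable formula evaluates while the
  coordinates in \<open>S\<close> stay fixed on their circles.\<close>

lemma Cauchy_closed_polydisc:
  fixes G :: "complex ^ 'n \<Rightarrow> complex"
  assumes R: "R > 0" and cont: "continuous_on (closed_polydisc R) G"
    and hol: "\<And>z j. z \<in> closed_polydisc R \<Longrightarrow>
      (\<lambda>u. G (\<chi> i. if i = j then u else z $ i)) holomorphic_on cball 0 R"
    and w: "\<And>i. norm (w $ i) < R"
  shows "(\<integral>x. G (circle_coords R S w x) *
      (\<Prod>j\<in>S. circlepath 0 R (x j) / (circlepath 0 R (x j) - w $ j))
      \<partial>Pi\<^sub>M S (\<lambda>_. unit_interval_measure)) = G w"
proof -
  interpret product_prob_space "\<lambda>_ :: 'n. unit_interval_measure" UNIV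
    by (rule product_prob_spaceI) (rule prob_space_unit_interval_measure)
  have wP: "w \<in> closed_polydisc R"
    using w by (auto simp: closed_polydisc_def less_imp_le)
  let ?c = "circlepath 0 R"
  define K where "K = (\<lambda>S x. \<Prod>j\<in>S. ?c (x j) / (?c (x j) - w $ j))"
  have "finite S" by simp
  then have "(\<integral>x. G (circle_coords R S w x) * K S x \<partial>Pi\<^sub>M S (\<lambda>_. unit_interval_measure)) = G w"
  proof (induction S)
    case empty
    interpret P0: prob_space "Pi\<^sub>M ({} :: 'n set) (\<lambda>_. unit_interval_measure)"
      by (intro prob_space_PiM prob_space_unit_interval_measure)
    show ?case by (simp add: K_def circle_coords_def P0.prob_space)
  next
    case (insert j S)
    have ne: "z $ i \<noteq> w $ i" if "norm (z $ i) = R" for z i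
      using that w[of i] by auto
    have "integrable (Pi\<^sub>M (insert j S) (\<lambda>_. unit_interval_measure))
      (\<lambda>x. (\<lambda>z. G z * (\<Prod>i\<in>insert j S. z $ i / (z $ i - w $ i))) (circle_coords R (insert j S) w x))"
      using R wP ne
      by (intro integrable_circle_coords)
         (auto intro!: continuous_intros continuous_on_subset[OF cont])
    then have int: "integrable (Pi\<^sub>M (insert j S) (\<lambda>_. unit_interval_measure))
      (\<lambda>x. G (circle_coords R (insert j S) w x) * K (insert j S) x)"
      by (simp add: K_def circle_coords_def)
    have inner: "(\<integral>y. G (circle_coords R (insert j S) w (x(j := y))) * K (insert j S) (x(j := y)) \<partial>unit_interval_measure)
        = G (circle_coords R S w x) * K S x" for x
    proof -
      define v where "v = circle_coords R S w x"
      have v: "v \<in> closed_polydisc R"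
        unfolding v_def using R by (intro circle_coords_in_closed_polydisc wP) simp
      have coords: "circle_coords R (insert j S) w (x(j := y)) = (\<chi> i. if i = j then ?c y else v $ i)" for y
        by (simp add: v_def circle_coords_def vec_eq_iff)
      have vj: "(\<chi> i. if i = j then w $ j else v $ i) = v"
        using insert(2) by (simp add: v_def circle_coords_def vec_eq_iff)
      have "K (insert j S) (x(j := y)) = ?c y / (?c y - w $ j) * K S x" for y
        unfolding K_def using insert(1,2) by (auto simp: intro!: prod.cong)
      then have "(\<integral>y. G (circle_coords R (insert j S) w (x(j := y))) * K (insert j S) (x(j := y)) \<partial>unit_interval_measure)
        = (\<integral>y. (G (\<chi> i. if i = j then ?c y else v $ i) * (?c y / (?c y - w $ j))) * K S x \<partial>unit_interval_measure)"
        by (simp add: coords mult.assoc)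
      also have "\<dots> = G (\<chi> i. if i = j then w $ j else v $ i) * K S x"
        by (simp only: integral_mult_left_zero circle_mean_Cauchy[OF R hol[OF v, of j] w[of j]])
      finally show ?thesis by (simp add: vj v_def)
    qed
    show ?case
      using insert by (simp add: product_integral_insert[OF insert(1,2) int] inner)
  qed
  then show ?thesis by (simp add: K_def)
qed

text \<open>The Taylor expansion in several variables. The coefficients are the means of
  \<open>G \<zeta> (\<Prod>\<^sub>j \<zeta>\<^sub>j powi (- k\<^sub>j))\<close> over \<open>|\<zeta>\<^sub>j| = R\<close>, which come from expanding the Cauchy kernel into
  geometric series.\<close>

lemma separately_holomorphic_power_series:
  fixes G :: "complex ^ 'n \<Rightarrow> complex"
  assumes R: "R > 0" and cont: "continuous_on (closed_polydisc R) G"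
    and hol: "\<And>z j. z \<in> closed_polydisc R \<Longrightarrow>
      (\<lambda>u. G (\<chi> i. if i = j then u else z $ i)) holomorphic_on cball 0 R"
  obtains a B where "\<And>k. norm (a k) * (\<Prod>i\<in>UNIV. R ^ k i) \<le> B"
    and "\<And>w. (\<And>i. norm (w $ i) < R) \<Longrightarrow> ((\<lambda>k. a k * (\<Prod>i\<in>UNIV. (w $ i) ^ k i)) has_sum G w) UNIV"
proof -
  let ?M = "Pi\<^sub>M (UNIV :: 'n set) (\<lambda>_. unit_interval_measure)"
  let ?c = "circlepath 0 R"
  let ?T = "{z :: complex ^ 'n. z \<in> closed_polydisc R \<and> (\<forall>i\<in>UNIV. norm (z $ i) = R)}"
  interpret prob_space ?M
    by (intro prob_space_PiM prob_space_unit_interval_measure)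
  have R0: "R \<ge> 0" "0 \<in> closed_polydisc R"
    using R by (auto simp: closed_polydisc_def)
  define p where "p = (\<lambda>x. circle_coords R UNIV (0 :: complex ^ 'n) x)"
  have p: "p x $ i = ?c (x i)" "p x \<in> closed_polydisc R" "circle_coords R UNIV w x = p x" for x i w
    using circle_coords_in_closed_polydisc[OF R0, of UNIV x] by (simp_all add: p_def circle_coords_def)
  have int: "integrable ?M (\<lambda>x. G (p x) * H (p x))" if "continuous_on ?T H" for H
    unfolding p_def using that
    by (intro integrable_circle_coords[OF R0, where \<Phi> = "\<lambda>z. G z * H z"] continuous_on_mult
        continuous_on_subset[OF cont]) auto
  have nz: "z $ i \<noteq> 0" if "norm (z $ i) = R" for z :: "complex ^ 'n" and i
    using that R by auto
  have "compact (G ` closed_polydisc R)"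
    using cont by (rule compact_continuous_image) (rule compact_closed_polydisc)
  then obtain B where B: "\<And>z. z \<in> closed_polydisc R \<Longrightarrow> norm (G z) \<le> B"
    by (meson bounded_iff compact_imp_bounded imageI)
  define a where "a = (\<lambda>k. \<integral>x. G (p x) * (\<Prod>i\<in>UNIV. (1 / p x $ i) ^ k i) \<partial>?M)"
  have intk: "integrable ?M (\<lambda>x. G (p x) * (\<Prod>i\<in>UNIV. (1 / p x $ i) ^ k i))" for k
    using nz by (intro int continuous_intros) auto
  have coeff_bound: "norm (a k) * (\<Prod>i\<in>UNIV. R ^ k i) \<le> B" for k
  proof -
    have "norm (a k) \<le> (\<integral>x. norm (G (p x) * (\<Prod>i\<in>UNIV. (1 / p x $ i) ^ k i)) \<partial>?M)"
      unfolding a_def by (rule integral_norm_bound)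
    also have "\<dots> \<le> (\<integral>x. B * (\<Prod>i\<in>UNIV. (1 / R) ^ k i) \<partial>?M)"
    proof (rule integral_mono)
      fix x
      show "norm (G (p x) * (\<Prod>i\<in>UNIV. (1 / p x $ i) ^ k i)) \<le> B * (\<Prod>i\<in>UNIV. (1 / R) ^ k i)"
        using R0 B[OF p(2)] by (simp add: norm_mult prod_norm[symmetric] norm_power norm_divide p(1) mult_right_mono prod_nonneg)
    qed (use intk in auto)
    also have "\<dots> = B * (\<Prod>i\<in>UNIV. (1 / R) ^ k i)"
      by (simp add: prob_space)
    finally have "norm (a k) * (\<Prod>i\<in>UNIV. R ^ k i) \<le> B * (\<Prod>i\<in>UNIV. (1 / R) ^ k i) * (\<Prod>i\<in>UNIV. R ^ k i)"
      using R0 by (intro mult_right_mono prod_nonneg) auto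
    also have "\<dots> = B"
      using R by (simp add: mult.assoc power_one_over flip: prod.distrib)
    finally show ?thesis .
  qed
  have "((\<lambda>k. a k * (\<Prod>i\<in>UNIV. (w $ i) ^ k i)) has_sum G w) UNIV" if w: "\<And>i. norm (w $ i) < R" for w
  proof -
    have ne: "z $ i \<noteq> w $ i" if "norm (z $ i) = R" for z i
      using that w[of i] by auto
    define f where "f = (\<lambda>k x. G (p x) * (\<Prod>i\<in>UNIV. (w $ i / p x $ i) ^ k i))"
    have "((\<lambda>k. integral\<^sup>L ?M (f k)) has_sum
        (\<integral>x. G (p x) * (\<Prod>i\<in>UNIV. p x $ i / (p x $ i - w $ i)) \<partial>?M)) UNIV"
    proof (rule has_sum_integral[where B = "\<lambda>k. B * (\<Prod>i\<in>UNIV. (norm (w $ i) / R) ^ k i)"])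
      show "prob_space ?M" by (rule prob_space_axioms)
      show "norm (f k x) \<le> B * (\<Prod>i\<in>UNIV. (norm (w $ i) / R) ^ k i)" for k x
        using R0 B[OF p(2)] unfolding f_def
        by (simp add: norm_mult prod_norm[symmetric] norm_power norm_divide p(1) mult_right_mono prod_nonneg)
      have "(\<lambda>k. \<Prod>i\<in>UNIV. (norm (w $ i) / R) ^ k i) summable_on UNIV"
        using R w by (intro has_sum_imp_summable[OF has_sum_prod_geometric]) (simp add: norm_divide)
      then show "(\<lambda>k. B * (\<Prod>i\<in>UNIV. (norm (w $ i) / R) ^ k i)) summable_on UNIV"
        by (rule summable_on_cmult_right)
      show "integrable ?M (f k)" for k
        unfolding f_def using nz by (intro int continuous_intros) auto
      show "((\<lambda>k. f k x) has_sum G (p x) * (\<Prod>i\<in>UNIV. p x $ i / (p x $ i - w $ i))) UNIV" for x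
      proof -
        have "((\<lambda>k. \<Prod>i\<in>UNIV. (w $ i / p x $ i) ^ k i) has_sum (\<Prod>i\<in>UNIV. 1 / (1 - w $ i / p x $ i))) UNIV"
          using R w by (intro has_sum_prod_geometric) (simp add: norm_divide p(1))
        moreover have "1 / (1 - w $ i / p x $ i) = p x $ i / (p x $ i - w $ i)" for i
          using nz[of "p x" i] R by (simp add: p(1) field_simps)
        ultimately show ?thesis
          unfolding f_def by (simp only: has_sum_cmult_right)
      qed
      show "integrable ?M (\<lambda>x. G (p x) * (\<Prod>i\<in>UNIV. p x $ i / (p x $ i - w $ i)))"
        using ne by (intro int continuous_intros) auto
    qed
    moreover have "integral\<^sup>L ?M (f k) = a k * (\<Prod>i\<in>UNIV. (w $ i) ^ k i)" for k
    proof -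
      have "f k = (\<lambda>x. G (p x) * (\<Prod>i\<in>UNIV. (1 / p x $ i) ^ k i) * (\<Prod>i\<in>UNIV. (w $ i) ^ k i))"
        unfolding f_def by (simp add: mult.assoc power_divide prod_dividef)
      then show ?thesis
        unfolding a_def by (simp only: integral_mult_left_zero)
    qed
    moreover have "(\<integral>x. G (p x) * (\<Prod>i\<in>UNIV. p x $ i / (p x $ i - w $ i)) \<partial>?M) = G w"
      using Cauchy_closed_polydisc[OF R cont hol w, of UNIV] by (simp add: p)
    ultimately show ?thesis by simp
  qed
  then show ?thesis using coeff_bound that by blast
qed

section \<open>Extendability and real analyticity on the torus\<close>

text \<open>The expansion of \<open>G w = F (exp (\<i> (\<theta> + w)))\<close> is used on the box of half the radius, where
  the bound on the coefficients leaves a convergent geometric majorant.\<close>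

lemma real_analytic_in_angles_if_extendable:
  fixes f :: "complex ^ 'n \<Rightarrow> complex"
  assumes "holomorphically_extendable_at f (torus_point \<theta>)"
  shows "real_analytic_in_angles f \<theta>"
proof -
  obtain U F where U: "open U" "torus_point \<theta> \<in> U" and F: "vec_holomorphic_on F U"
    and Ff: "\<And>z. z \<in> U \<Longrightarrow> z \<in> torus \<Longrightarrow> F z = f z"
    using assms unfolding holomorphically_extendable_at_def by blast
  define h where "h = (\<lambda>i u. exp (\<i> * (complex_of_real (\<theta> $ i) + u)))"
  define G where "G = (\<lambda>z. F (\<chi> i. h i (z $ i)))"
  define V where "V = (\<lambda>z. \<chi> i. h i (z $ i)) -` U"
  have "open V"
    unfolding V_def h_def using U(1) by (intro open_vimage continuous_intros)
  moreover have "0 \<in> V"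
    using U(2) by (simp add: V_def h_def torus_point_def cis_conv_exp)
  ultimately obtain R where R: "R > 0" "closed_polydisc R \<subseteq> V"
    by (rule closed_polydisc_subset_open)
  have "h i field_differentiable (at u)" for i u
    unfolding h_def field_differentiable_def by (rule exI) (auto intro!: derivative_eq_intros)
  then have G: "vec_holomorphic_on G V"
    unfolding G_def by (intro vec_holomorphic_on_coordinatewise[OF F]) (auto simp: V_def)
  then have "continuous_on V G"
    unfolding vec_holomorphic_on_def
    by (meson continuous_at_imp_continuous_on has_derivative_continuous)
  then have cont: "continuous_on (closed_polydisc R) G"
    using R(2) by (rule continuous_on_subset)
  have hol: "(\<lambda>u. G (\<chi> i. if i = j then u else z $ i)) holomorphic_on cball 0 R"
    if "z \<in> closed_polydisc R" for z j
    using that by (intro vec_holomorphic_on_coordinate_line[OF G] subsetD[OF R(2)])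
      (auto simp: closed_polydisc_def)
  obtain a B where B: "\<And>k. norm (a k) * (\<Prod>i\<in>UNIV. R ^ k i) \<le> B"
    and series: "\<And>w. (\<And>i. norm (w $ i) < R) \<Longrightarrow>
      ((\<lambda>k. a k * (\<Prod>i\<in>UNIV. (w $ i) ^ k i)) has_sum G w) UNIV"
    using separately_holomorphic_power_series[OF R(1) cont hol] by blast
  let ?box = "box_around \<theta> (R / 2)"
  define M where "M = (\<lambda>k :: 'n \<Rightarrow> nat. B * (\<Prod>i\<in>UNIV. (1 / 2 :: real) ^ k i))"
  have M: "M summable_on UNIV"
    unfolding M_def
    by (intro summable_on_cmult_right has_sum_imp_summable[OF has_sum_prod_geometric]) simp
  have small: "\<bar>t $ i - \<theta> $ i\<bar> \<le> R / 2" if "t \<in> ?box" for t i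
  proof -
    have "t $ i \<in> {\<theta> $ i - R / 2 .. \<theta> $ i + R / 2}"
      using that unfolding box_around_def by blast
    then show ?thesis unfolding atLeastAtMost_iff by linarith
  qed
  have bound: "norm (series_term a \<theta> k t) \<le> M k" if t: "t \<in> ?box" for k t
  proof -
    have "norm (series_term a \<theta> k t) = norm (a k) * (\<Prod>i\<in>UNIV. \<bar>t $ i - \<theta> $ i\<bar> ^ k i)"
      by (simp only: series_term_def norm_mult prod_norm[symmetric] norm_power norm_of_real)
    also have "\<dots> \<le> norm (a k) * (\<Prod>i\<in>UNIV. (R / 2) ^ k i)"
      using small[OF t] by (intro mult_left_mono prod_mono conjI power_mono) auto
    also have "\<dots> = (norm (a k) * (\<Prod>i\<in>UNIV. R ^ k i)) * (\<Prod>i\<in>UNIV. (1 / 2) ^ k i)"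
      by (simp add: mult.assoc power_divide prod_dividef)
    also have "\<dots> \<le> M k"
      unfolding M_def by (intro mult_right_mono B prod_nonneg) auto
    finally show ?thesis .
  qed
  have val: "((\<lambda>k. series_term a \<theta> k t) has_sum f (torus_point t)) UNIV" if t: "t \<in> ?box" for t
  proof -
    define w where "w = (\<chi> i. complex_of_real (t $ i - \<theta> $ i))"
    have w: "norm (w $ i) < R" for i
      using small[OF t, of i] R(1) by (simp only: w_def vec_lambda_beta norm_of_real)
    have hw: "(\<chi> i. h i (w $ i)) = torus_point t"
      by (simp add: h_def w_def torus_point_def cis_conv_exp)
    have "w \<in> closed_polydisc R"
      using w by (auto simp: closed_polydisc_def less_imp_le)
    then have "torus_point t \<in> U"
      using R(2) hw by (auto simp: V_def)
    then have "G w = f (torus_point t)"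
      using Ff[of "torus_point t"] by (simp add: G_def hw) (simp add: torus_def torus_point_def)
    then show ?thesis
      using series[OF w] by (simp add: series_term_def w_def)
  qed
  show ?thesis
    unfolding real_analytic_in_angles_def
  proof (intro exI[of _ "R / 2"] exI[of _ a] conjI ballI)
    show "R / 2 > 0" using R(1) by simp
    show "(\<lambda>k. norm (series_term a \<theta> k t)) summable_on UNIV" if "t \<in> ?box" for t
      using bound[OF that] by (intro summable_on_comparison_test[OF M]) auto
    show "uniform_limit ?box (\<lambda>K t. \<Sum>k\<in>K. series_term a \<theta> k t)
        (\<lambda>t. \<Sum>\<^sub>\<infinity>k. series_term a \<theta> k t) (finite_subsets_at_top UNIV)"
      using bound M by (intro Weierstrass_m_test_general)
    show "(\<Sum>\<^sub>\<infinity>k. series_term a \<theta> k t) = f (torus_point t)" if "t \<in> ?box" for t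
      using val[OF that] by (rule infsumI)
  qed
qed

text \<open>Near \<open>torus_point \<theta>\<close> the functions \<open>- \<i> Ln (z\<^sub>j / exp (\<i> \<theta>\<^sub>j))\<close> recover the angles
  relative to \<open>\<theta>\<close>. They are real on the torus, where the power series therefore takes the values
  of \<open>f\<close>, and small near the point, where it therefore converges.\<close>

lemma extendable_if_real_analytic_in_angles:
  fixes f :: "complex ^ 'n \<Rightarrow> complex"
  assumes "real_analytic_in_angles f \<theta>"
  shows "holomorphically_extendable_at f (torus_point \<theta>)"
proof -
  obtain \<delta> a where \<delta>: "\<delta> > 0"
    and abs: "\<And>t. t \<in> box_around \<theta> \<delta> \<Longrightarrow> (\<lambda>k. norm (series_term a \<theta> k t)) summable_on UNIV"
    and val: "\<And>t. t \<in> box_around \<theta> \<delta> \<Longrightarrow> (\<Sum>\<^sub>\<infinity>k. series_term a \<theta> k t) = f (torus_point t)"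
    using assms unfolding real_analytic_in_angles_def by blast
  define P where "P = (\<lambda>w :: complex ^ 'n. \<Sum>\<^sub>\<infinity>k. a k * (\<Prod>i\<in>UNIV. (w $ i) ^ k i))"
  \<comment> \<open>The corner of the box carries the bound for the complex polydisc of radius \<open>\<delta>\<close>.\<close>
  have "(\<lambda>k. norm (series_term a \<theta> k (\<chi> i. \<theta> $ i + \<delta>))) summable_on UNIV"
    using \<delta> by (intro abs) (simp add: box_around_def)
  also have "(\<lambda>k. norm (series_term a \<theta> k (\<chi> i. \<theta> $ i + \<delta>))) = (\<lambda>k. norm (a k) * (\<Prod>i\<in>UNIV. \<delta> ^ k i))"
    using \<delta> by (simp add: series_term_def norm_mult prod_norm[symmetric] norm_power)
  finally have P: "vec_holomorphic_on P {w. \<forall>i. norm (w $ i) < \<delta>}"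
    unfolding P_def by (rule vec_holomorphic_on_power_series)
  \<comment> \<open>Off the branch cut of the logarithm, which is avoided near 1.\<close>
  define V where "V = - \<real>\<^sub>\<le>\<^sub>0 \<inter> Ln -` ball 0 \<delta>"
  have "continuous_on (- \<real>\<^sub>\<le>\<^sub>0) Ln"
    by (intro continuous_on_Ln continuous_on_id) auto
  then have V: "open V"
    unfolding V_def by (intro continuous_open_preimage open_ball) (auto simp: closed_nonpos_Reals_complex)
  define U where "U = {z :: complex ^ 'n. \<forall>i. z $ i \<in> (\<lambda>u. u / cis (\<theta> $ i)) -` V}"
  have "open U"
    unfolding U_def using V by (intro open_vector_box allI open_vimage continuous_intros) auto
  moreover have "torus_point \<theta> \<in> U"
    using \<delta> by (simp add: U_def V_def torus_point_def)
  moreover have "vec_holomorphic_on (\<lambda>z. P (\<chi> i. - \<i> * Ln (z $ i / cis (\<theta> $ i)))) U"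
  proof (rule vec_holomorphic_on_coordinatewise[OF P])
    fix z i assume "z \<in> U"
    then have z: "z $ i / cis (\<theta> $ i) \<in> V" for i
      by (simp add: U_def)
    show "(\<chi> i. - \<i> * Ln (z $ i / cis (\<theta> $ i))) \<in> {w. \<forall>i. norm (w $ i) < \<delta>}"
      using z by (simp add: V_def norm_mult)
    have "(\<lambda>u. - \<i> * Ln (u / cis (\<theta> $ i))) holomorphic_on (\<lambda>u. u / cis (\<theta> $ i)) -` V"
      by (intro holomorphic_intros) (auto simp: V_def)
    moreover have "open ((\<lambda>u. u / cis (\<theta> $ i)) -` V)"
      using V by (intro open_vimage continuous_intros) auto
    ultimately show "(\<lambda>u. - \<i> * Ln (u / cis (\<theta> $ i))) field_differentiable (at (z $ i))"
      using z[of i] by (auto intro: holomorphic_on_imp_differentiable_at)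
  qed
  moreover have "P (\<chi> i. - \<i> * Ln (z $ i / cis (\<theta> $ i))) = f z" if z: "z \<in> U" "z \<in> torus" for z
  proof -
    define s where "s = (\<lambda>i. Arg (z $ i / cis (\<theta> $ i)))"
    have n: "norm (z $ i / cis (\<theta> $ i)) = 1" for i
      using z(2) by (simp add: torus_def norm_divide)
    have nz: "z $ i / cis (\<theta> $ i) \<noteq> 0" for i
      using n[of i] by (metis norm_zero zero_neq_one)
    have Ln: "Ln (z $ i / cis (\<theta> $ i)) = \<i> * complex_of_real (s i)" for i
      using Ln_Arg[OF nz[of i]] n[of i] by (simp only: s_def) simp
    have "cis (s i) = z $ i / cis (\<theta> $ i)" for i
      using exp_Ln[OF nz[of i]] unfolding Ln by (simp only: cis_conv_exp)
    then have zt: "z = torus_point (\<chi> i. \<theta> $ i + s i)"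
      by (simp add: torus_point_def vec_eq_iff flip: cis_mult)
    have "norm (Ln (z $ i / cis (\<theta> $ i))) < \<delta>" for i
      using z(1) by (simp add: U_def V_def)
    then have "\<bar>s i\<bar> < \<delta>" for i
      by (simp add: Ln norm_mult)
    then have "(\<chi> i. \<theta> $ i + s i) \<in> box_around \<theta> \<delta>"
      by (auto simp: box_around_def abs_less_iff less_imp_le intro: order.strict_implies_order) (smt (verit))
    then have "f z = (\<Sum>\<^sub>\<infinity>k. series_term a \<theta> k (\<chi> i. \<theta> $ i + s i))"
      using val zt by metis
    also have "\<dots> = P (\<chi> i. - \<i> * Ln (z $ i / cis (\<theta> $ i)))"
      unfolding Ln by (simp add: P_def series_term_def)
    finally show ?thesis ..
  qed
  ultimately show ?thesis
    unfolding holomorphically_extendable_at_def by blast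
qed

theorem proposition8:
  fixes f :: "complex ^ 'n \<Rightarrow> complex" and p :: "complex ^ 'n"
  assumes "p \<in> torus"
  shows "holomorphically_extendable_at f p \<longleftrightarrow> real_analytic_at f p"
proof -
  have "cis (Arg (p $ i)) = p $ i" for i
  proof -
    have "norm (p $ i) = 1" using assms by (simp add: torus_def)
    then show ?thesis by (metis cis_Arg div_by_1 norm_eq_zero of_real_1 sgn_eq zero_neq_one)
  qed
  then have "p = torus_point (\<chi> i. Arg (p $ i))"
    by (simp add: torus_point_def vec_eq_iff)
  then show ?thesis
    using real_analytic_in_angles_if_extendable extendable_if_real_analytic_in_angles
      real_analytic_at_torus_point by metis
qed

end
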